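(* Let $G$ be a finite simple graph with vertex set $[n]=\{1,\dots,n\}$ and let $\boldsymbol{p}=(p_1,\dots,p_n)\in[0,1)^n$. Then $\boldsymbol{p}\in\mathcal{S}(G)$ if and only if there exist a set of walks $\mathcal{W}\supseteq\mathcal{B}(G)$ on $G$ and a number $r_{\widetilde{w}}\in[0,1)$ for each $\widetilde{w}\in C(\mathcal{W})$, such that for every $\widetilde{w}\in C(\mathcal{W})$, $p_{\mathrm{t}(\widetilde{w})}\le r_{\widetilde{w}}\prod_{y\in\mathrm{Ext}(\widetilde{w})}(1-r_{\widetilde{y}})$.
   Context: $\Gamma_i$ denotes the set of neighbors of vertex $i$ in $G$. Avoidance probability and $\mathcal{S}(G)$: Let $\mu$ be a probability measure and $F_1,\dots,F_n$ events with $\mu(F_i)=p_i$. $G$ is a dependency graph for $F_1,\dots,F_n$ with respect to $\mu$ if for every $i\in[n]$ and every $\{j_1,j_2,\dots\}\subseteq[n]\setminus(\Gamma_i\cup\{i\})$ we have $\mu(F_i\mid \overline{F_{j_1}}\cap\overline{F_{j_2}}\cap\cdots)=p_i$ (whenever the conditioning event has positive probability). $\mathrm{avoid}(\boldsymbol{p},G)$ is the smallest possible value of $\mu(\overline{F_1}\cap\cdots\cap\overline{F_n})$ over all probability spaces and events with $\mu(F_i)=p_i$ for all $i$ for which $G$ is a dependency graph. $\mathcal{S}(G)=\{\boldsymbol{p}\in[0,1)^n:\mathrm{avoid}(\boldsymbol{p},G)>0\}$. Walks: A walk on $G$ is a nonempty finite string of vertices in which every two successive characters are adjacent in $G$. For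 a walk $w$, $\mathrm{t}(w)$ denotes its last vertex. For a set of walks $\mathcal{W}$ and $w\in\mathcal{W}$, $\mathrm{Ext}(w)$ is the set of walks in $\mathcal{W}$ that extend $w$ by one vertex at its end. Empty products equal 1. Self-bounding walks: a walk is self-bounding if, starting with the set of forbidden vertices consisting of just its starting vertex, in each step the walk (i) proceeds from the current vertex $i$ to a vertex $j\in\Gamma_i$ that is not currently forbidden, and (ii) adds to the set of forbidden vertices all neighbors of $i$ that are greater than or equal to $j$ (in the usual order on $[n]$). Forbidden vertices remain forbidden. $\mathcal{B}(G)$ is the set of self-bounding walks on $G$ (including single-vertex walks). Equivalence classes: for $w,w'\in\mathcal{W}$, write $w\sim w'$ if $\mathrm{t}(w)=\mathrm{t}(w')$ and $\{z: wz\in\mathcal{W}\}=\{z: w'z\in\mathcal{W}\}$, where $z$ ranges over strings over $[n]$ and $wz$ is concatenation. $\widetilde{w}$ denotes the equivalence class of $w$, and $C(\mathcal{W})$ the set of equivalence classes. If $w\sim w'$, then $wx\in\mathcal{W}$ iff $w'x\in\mathcal{W}$ for each vertex $x$, and in that case $wx\sim w'x$. So $\mathrm{t}(\widetilde{w}):=\mathrm{t}(w)$ and the product over $y\in\mathrm{Ext}(\widetilde{w})$ of terms depending only on the class $\widetilde{y}$, meaning the product over $y\in\mathrm{Ext}(w)$ for any representative $w$, are well defined. *)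

theory Defs
  imports "HOL-Probability.Probability"
begin

definition simple_graph_on :: "nat \<Rightarrow> (nat \<times> nat) set \<Rightarrow> bool" where
  "simple_graph_on n E \<longleftrightarrow> E \<subseteq> {1..n} \<times> {1..n} \<and> sym E \<and> irrefl E"

definition neighbors :: "(nat \<times> nat) set \<Rightarrow> nat \<Rightarrow> nat set" where
  "neighbors E i = {j. (i, j) \<in> E}"


definition dependency_graph ::
    "nat \<Rightarrow> (nat \<times> nat) set \<Rightarrow> 'a measure \<Rightarrow> (nat \<Rightarrow> 'a set) \<Rightarrow> bool" where
  "dependency_graph n E M F \<longleftrightarrow>
     (\<forall>i\<in>{1..n}. \<forall>J. J \<subseteq> {1..n} - (neighbors E i \<union> {i}) \<longrightarrow>
        \<P>(x in M. \<forall>j\<in>J. x \<notin> F j) > 0 \<longrightarrow>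
        \<P>(x in M. x \<in> F i \<bar> \<forall>j\<in>J. x \<notin> F j) = measure M (F i))"

definition admissible_events ::
    "nat \<Rightarrow> (nat \<times> nat) set \<Rightarrow> (nat \<Rightarrow> real) \<Rightarrow> 'a measure \<Rightarrow> (nat \<Rightarrow> 'a set) \<Rightarrow> bool" where
  "admissible_events n E p M F \<longleftrightarrow>
     prob_space M \<and> (\<forall>i\<in>{1..n}. F i \<in> sets M \<and> measure M (F i) = p i) \<and>
     dependency_graph n E M F"

definition avoidance :: "nat \<Rightarrow> 'a measure \<Rightarrow> (nat \<Rightarrow> 'a set) \<Rightarrow> real" where
  "avoidance n M F = \<P>(x in M. \<forall>i\<in>{1..n}. x \<notin> F i)"

text \<open>
  A definition cannot quantify over all types of outcomes, so the probability spaces below live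
  on \<^typ>\<open>nat set\<close>. This loses nothing: the lemma \<open>avoid_le_avoidance\<close> shows that
  the resulting value is a lower bound for probability spaces over every type (push the measure
  forward along the map that sends an outcome to the set of indices of the events it belongs to).
  The set of possible values is nonempty (independent events) and closed, so its infimum is its
  minimum.
\<close>

definition avoid :: "nat \<Rightarrow> (nat \<times> nat) set \<Rightarrow> (nat \<Rightarrow> real) \<Rightarrow> real" where
  "avoid n E p =
     Inf {avoidance n M F | (M :: nat set measure) F. admissible_events n E p M F}"

lemma avoid_le_avoidance:
  fixes M :: "'a measure"
  assumes "admissible_events n E p M F"
  shows "avoid n E p \<le> avoidance n M F"
proof -
  define h where "h x = {i\<in>{1..n}. x \<in> F i}" for x
  define N where "N = distr M (count_space (Pow {1..n})) h"
  define G where "G i = {S \<in> Pow {1..n}. i \<in> S}" for i :: nat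
  from assms have M: "prob_space M" and F: "\<And>i. i \<in> {1..n} \<Longrightarrow> F i \<in> sets M"
    and p: "\<And>i. i \<in> {1..n} \<Longrightarrow> measure M (F i) = p i" and dep: "dependency_graph n E M F"
    by (auto simp: admissible_events_def)
  interpret prob_space M by (rule M)
  have h: "h \<in> measurable M (count_space (Pow {1..n}))"
  proof (subst measurable_count_space_eq2, simp, safe)
    fix S assume S: "S \<subseteq> {1..n}"
    have "h -` {S} \<inter> space M =
        {x \<in> space M. \<forall>i\<in>{1..n}. if i \<in> S then x \<in> F i else x \<notin> F i}"
    proof -
      have "h x = S \<longleftrightarrow> (\<forall>i\<in>{1..n}. i \<in> S \<longleftrightarrow> x \<in> F i)" for x
        using S unfolding h_def by blast
      then show ?thesis by auto
    qed
    moreover have "\<dots> \<in> sets M"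
    proof (rule sets.sets_Collect_finite_All)
      fix i assume "i \<in> {1..n}"
      then have "F i \<in> sets M" by (rule F)
      then show "{x \<in> space M. if i \<in> S then x \<in> F i else x \<notin> F i} \<in> sets M"
        by (cases "i \<in> S") auto
    qed simp
    ultimately show "h -` {S} \<inter> space M \<in> sets M" by simp
  qed (auto simp: h_def)
  have transfer: "\<P>(S in N. Q S) = \<P>(x in M. Q (h x))" for Q
  proof -
    have "\<P>(S in N. Q S) = measure M (h -` {S \<in> space N. Q S} \<inter> space M)"
      unfolding N_def by (rule measure_distr[OF h]) auto
    also have "h -` {S \<in> space N. Q S} \<inter> space M = {x \<in> space M. Q (h x)}"
      by (auto simp: N_def h_def)
    finally show ?thesis .
  qed
  have hG: "h x \<in> G i \<longleftrightarrow> x \<in> F i" if "i \<in> {1..n}" for x i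
    using that by (auto simp: h_def G_def)
  have G: "measure N (G i) = measure M (F i)" if i: "i \<in> {1..n}" for i
  proof -
    have "G i = {S \<in> space N. S \<in> G i}" "F i = {x \<in> space M. x \<in> F i}"
      using sets.sets_into_space[OF F[OF i]] by (auto simp: G_def N_def)
    then show ?thesis using transfer[of "\<lambda>S. S \<in> G i"] hG[OF i] by simp
  qed
  have "dependency_graph n E N G"
    unfolding dependency_graph_def cond_prob_def transfer
  proof (intro ballI allI impI)
    fix i J
    assume i: "i \<in> {1..n}" and J: "J \<subseteq> {1..n} - (neighbors E i \<union> {i})"
      and pos: "0 < \<P>(x in M. \<forall>j\<in>J. h x \<notin> G j)"
    have eq: "(\<forall>j\<in>J. h x \<notin> G j) \<longleftrightarrow> (\<forall>j\<in>J. x \<notin> F j)" for x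
      using J hG by blast
    show "\<P>(x in M. h x \<in> G i \<and> (\<forall>j\<in>J. h x \<notin> G j)) / \<P>(x in M. \<forall>j\<in>J. h x \<notin> G j)
        = measure N (G i)"
      using dep i J pos
      unfolding eq hG[OF i] G[OF i] dependency_graph_def cond_prob_def by blast
  qed
  moreover have "prob_space N" unfolding N_def by (rule prob_space_distr[OF h])
  moreover have "G i \<in> sets N" for i by (auto simp: N_def G_def)
  ultimately have adm: "admissible_events n E p N G"
    using G p by (auto simp: admissible_events_def)
  have "avoidance n N G = avoidance n M F"
    unfolding avoidance_def transfer using hG by (intro arg_cong[where f = "measure M"]) blast
  moreover have "avoid n E p \<le> avoidance n N G"
    unfolding avoid_def
    by (rule cInf_lower) (use adm in \<open>auto intro!: bdd_belowI[of _ 0] simp: avoidance_def\<close>)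
  ultimately show ?thesis by simp
qed

text \<open>Values of \<open>p\<close> outside \<open>{1..n}\<close> are irrelevant and left unconstrained.\<close>

definition shearer_set :: "nat \<Rightarrow> (nat \<times> nat) set \<Rightarrow> (nat \<Rightarrow> real) set" where
  "shearer_set n E = {p. (\<forall>i\<in>{1..n}. p i \<in> {0..<1}) \<and> avoid n E p > 0}"


definition walks :: "nat \<Rightarrow> (nat \<times> nat) set \<Rightarrow> nat list set" where
  "walks n E = {w. w \<noteq> [] \<and> set w \<subseteq> {1..n} \<and> successively (\<lambda>i j. j \<in> neighbors E i) w}"

definition Ext :: "nat list set \<Rightarrow> nat list \<Rightarrow> nat list set" where
  "Ext W w = {y \<in> W. \<exists>x. y = w @ [x]}"

text \<open>
  \<open>self_bounding n E w D\<close>: the walk \<open>w\<close> is self-bounding, and \<open>D\<close> is the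
  set of forbidden vertices after its last step.
\<close>

inductive self_bounding :: "nat \<Rightarrow> (nat \<times> nat) set \<Rightarrow> nat list \<Rightarrow> nat set \<Rightarrow> bool"
  for n :: nat and E :: "(nat \<times> nat) set" where
  start: "i \<in> {1..n} \<Longrightarrow> self_bounding n E [i] {i}"
| step: "self_bounding n E w D \<Longrightarrow> i = last w \<Longrightarrow> j \<in> neighbors E i \<Longrightarrow> j \<notin> D \<Longrightarrow>
    self_bounding n E (w @ [j]) (D \<union> {k \<in> neighbors E i. k \<ge> j})"

definition self_bounding_walks :: "nat \<Rightarrow> (nat \<times> nat) set \<Rightarrow> nat list set" where
  "self_bounding_walks n E = {w. \<exists>D. self_bounding n E w D}"

definition walk_rel :: "nat list set \<Rightarrow> (nat list \<times> nat list) set" where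
  "walk_rel W = {(w, w'). w \<in> W \<and> w' \<in> W \<and> last w = last w' \<and>
     {z. w @ z \<in> W} = {z. w' @ z \<in> W}}"

definition walk_class :: "nat list set \<Rightarrow> nat list \<Rightarrow> nat list set" where
  "walk_class W w = walk_rel W `` {w}"

definition walk_classes :: "nat list set \<Rightarrow> nat list set set" where
  "walk_classes W = W // walk_rel W"

end

theory Submission
  imports Defs
begin

text \<open>
  Write \<open>Z S\<close> for the independence polynomial of the subgraph induced on \<open>S\<close>, evaluated at \<open>-p\<close>;
  it satisfies \<open>Z (S \<union> {i}) = Z S - p i * Z (S - \<Gamma> i)\<close>, and avoidance probabilities satisfy the same
  relation with \<open>\<ge>\<close>. If the walk conditions hold, then by induction on \<open>S\<close> every self-bounding walk \<open>w\<close>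
  from \<open>W\<close> whose forbidden vertices avoid \<open>S\<close> gives
  \<open>P(avoid S \<union> {last w}) \<ge> (1 - r w) * P(avoid S)\<close>: the neighbors of \<open>last w\<close> in \<open>S\<close> are removed from
  the greatest to the least, and each removal is an instance of the claim for a one-step extension
  of \<open>w\<close>. So the avoidance probability is at least the product of all \<open>1 - r [i]\<close>.

  Conversely, if \<open>Z S \<le> 0\<close> for some minimal \<open>S\<close>, lowering one \<open>p i\<close> with \<open>i \<in> S\<close> until \<open>Z S = 0\<close> and
  putting \<open>p = 0\<close> outside \<open>S\<close> keeps \<open>Z\<close> nonnegative, so Shearer's extremal measure exists there and
  avoids all events with probability 0; enlarging the events by independent ones restores \<open>p\<close>.
  Hence \<open>Z > 0\<close> on \<open>shearer_set\<close>, and then \<open>W\<close> can be the set of self-bounding walks, with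
  \<open>1 - r w = Z (U \<union> {last w}) / Z U\<close> for \<open>U\<close> the set of non-forbidden vertices. The inequalities hold
  with equality because the product telescopes, and these equations determine \<open>r w\<close> from the tree of
  extensions of \<open>w\<close>, so that \<open>r\<close> depends only on the class of \<open>w\<close>.
\<close>

subsection \<open>The independence polynomial\<close>

lemma sum_Pow_insert:
  fixes f :: "'a set \<Rightarrow> real"
  assumes "finite R" "a \<notin> R"
  shows "(\<Sum>X\<in>Pow (insert a R). f X) = (\<Sum>X\<in>Pow R. f X) + (\<Sum>X\<in>Pow R. f (insert a X))"
proof -
  have "inj_on (insert a) (Pow R)"
    using assms(2) by (auto simp: inj_on_def)
  moreover have "Pow R \<inter> insert a ` Pow R = {}"
    using assms(2) by auto
  ultimately show ?thesis
    using assms(1) by (simp add: Pow_insert sum.union_disjoint sum.reindex)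
qed

definition indep :: "(nat \<times> nat) set \<Rightarrow> nat set \<Rightarrow> bool" where
  "indep E I \<longleftrightarrow> (\<forall>i\<in>I. \<forall>j\<in>I. (i, j) \<notin> E)"

text \<open>This is \<open>Z S\<close>. Summing over the whole power set, with zero terms for sets
  that are not independent, lets \<open>sum_Pow_insert\<close> split off a vertex.\<close>

definition indep_poly :: "(nat \<times> nat) set \<Rightarrow> (nat \<Rightarrow> real) \<Rightarrow> nat set \<Rightarrow> real" where
  "indep_poly E p S = (\<Sum>I\<in>Pow S. if indep E I then \<Prod>i\<in>I. - p i else 0)"

lemma indep_poly_empty [simp]: "indep_poly E p {} = 1"
  by (simp add: indep_poly_def indep_def)

lemma indep_poly_cong:
  "(\<And>i. i \<in> S \<Longrightarrow> p i = q i) \<Longrightarrow> indep_poly E p S = indep_poly E q S"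
  unfolding indep_poly_def by (intro sum.cong refl if_cong prod.cong) auto

lemma indep_insert:
  assumes "sym E" "irrefl E"
  shows "indep E (insert i I) \<longleftrightarrow> indep E I \<and> I \<inter> neighbors E i = {}"
  using assms by (auto simp: indep_def neighbors_def irrefl_def dest: symD)

text \<open>The independent sets containing \<open>i\<close> are the \<open>insert i I\<close> with
  \<open>I\<close> independent and disjoint from the neighbors of \<open>i\<close>. Each carries the
  factor \<open>- p i\<close>, and the rest sums to the polynomial of
  \<open>S - neighbors E i\<close>.\<close>

lemma indep_poly_insert:
  assumes E: "sym E" "irrefl E" and S: "finite S" "i \<notin> S"
  shows "indep_poly E p (insert i S) = indep_poly E p S - p i * indep_poly E p (S - neighbors E i)"
proof -
  have "(if indep E (insert i I) then \<Prod>j\<in>insert i I. - p j else 0) =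
      - p i * (if I \<in> Pow (S - neighbors E i) then if indep E I then \<Prod>j\<in>I. - p j else 0 else 0)"
    if "I \<in> Pow S" for I
  proof -
    have "finite I" "i \<notin> I" using that S finite_subset by auto
    then show ?thesis using that indep_insert[OF E, of i I] by auto
  qed
  then have "(\<Sum>I\<in>Pow S. if indep E (insert i I) then \<Prod>j\<in>insert i I. - p j else 0) =
     - p i * (\<Sum>I\<in>Pow S. if I \<in> Pow (S - neighbors E i) then if indep E I then \<Prod>j\<in>I. - p j else 0 else 0)"
    unfolding sum_distrib_left by (intro sum.cong refl)
  also have "(\<Sum>I\<in>Pow S. if I \<in> Pow (S - neighbors E i) then if indep E I then \<Prod>j\<in>I. - p j else 0 else 0)
      = indep_poly E p (S - neighbors E i)"
    unfolding indep_poly_def using S(1) by (intro sum.mono_neutral_cong_right) auto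
  finally show ?thesis
    using sum_Pow_insert[OF S, of "\<lambda>I. if indep E I then \<Prod>j\<in>I. - p j else 0"]
    by (simp add: indep_poly_def)
qed

text \<open>Without edges the recursion just multiplies by \<open>1 - p i\<close>. Mutually
  independent events thereby become the edgeless case of Shearer's construction.\<close>

lemma indep_poly_no_edges:
  assumes "finite S"
  shows "indep_poly {} p S = (\<Prod>i\<in>S. 1 - p i)"
  using assms
proof (induction S)
  case (insert i S)
  then show ?case
    using indep_poly_insert[of "{}" S i p] by (simp add: neighbors_def sym_def irrefl_def algebra_simps)
qed simp

lemma indep_poly_outside:
  assumes E: "sym E" "irrefl E" and fin: "finite S" "finite T" and p0: "\<And>i. i \<in> T \<Longrightarrow> p i = 0"
  shows "indep_poly E p (S \<union> T) = indep_poly E p S"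
  using fin(2) p0
proof (induction T)
  case (insert i T)
  then show ?case
    using indep_poly_insert[OF E, of "S \<union> T" i p] fin(1)
    by (cases "i \<in> S") (auto simp: insert_absorb)
qed simp

subsection \<open>Shearer's extremal measure\<close>

text \<open>In Shearer's extremal measure this is the probability that all events in \<open>T\<close> and no events
  in \<open>S\<close> occur.\<close>

definition cell_weight ::
    "(nat \<times> nat) set \<Rightarrow> (nat \<Rightarrow> real) \<Rightarrow> nat set \<Rightarrow> nat set \<Rightarrow> real" where
  "cell_weight E p T S =
     (if indep E T then (\<Prod>i\<in>T. p i) * indep_poly E p (S - (\<Union>i\<in>T. neighbors E i)) else 0)"

text \<open>The cell is divided according to whether event \<open>i\<close> occurs. If
  \<open>i\<close> has a neighbor in \<open>T\<close>, it cannot occur and the polynomial already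
  omits it; otherwise this is \<open>indep_poly_insert\<close> multiplied by the product over
  \<open>T\<close>.\<close>

lemma cell_weight_split:
  assumes E: "sym E" "irrefl E" and fin: "finite T" "finite S" and i: "i \<notin> T" "i \<notin> S"
  shows "cell_weight E p T S = cell_weight E p (insert i T) S + cell_weight E p T (insert i S)"
proof -
  let ?N = "\<Union>i\<in>T. neighbors E i"
  have N: "T \<inter> neighbors E i = {} \<longleftrightarrow> i \<notin> ?N"
    using E(1) by (auto simp: neighbors_def dest: symD)
  show ?thesis
  proof (cases "i \<in> ?N")
    case True
    then have "insert i S - ?N = S - ?N" by auto
    with True show ?thesis unfolding cell_weight_def indep_insert[OF E] N by simp
  next
    case False
    then have "insert i S - ?N = insert i (S - ?N)"
        "S - (\<Union>i\<in>insert i T. neighbors E i) = S - ?N - neighbors E i"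
      by auto
    then have eq: "indep_poly E p (S - ?N) =
        indep_poly E p (insert i S - ?N) + p i * indep_poly E p (S - (\<Union>i\<in>insert i T. neighbors E i))"
      using indep_poly_insert[OF E, of "S - ?N" i p] fin i by simp
    with False show ?thesis
      using i fin unfolding cell_weight_def indep_insert[OF E] N eq by (simp add: algebra_simps)
  qed
qed

text \<open>Splitting at each vertex of \<open>R\<close> in turn; \<open>X\<close> collects the
  events of \<open>R\<close> that occur. With \<open>R\<close> the set of all remaining vertices,
  the cell becomes a sum of atoms.\<close>

lemma cell_weight_refine:
  assumes E: "sym E" "irrefl E" and fin: "finite R" "finite T" "finite S"
    and disj: "R \<inter> T = {}" "R \<inter> S = {}"
  shows "cell_weight E p T S = (\<Sum>X\<in>Pow R. cell_weight E p (T \<union> X) (S \<union> (R - X)))"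
  using fin disj
proof (induction R arbitrary: T S)
  case (insert a R)
  have "(\<Sum>X\<in>Pow (insert a R). cell_weight E p (T \<union> X) (S \<union> (insert a R - X))) =
     (\<Sum>X\<in>Pow R. cell_weight E p (T \<union> X) (insert a S \<union> (R - X))) +
     (\<Sum>X\<in>Pow R. cell_weight E p (insert a T \<union> X) (S \<union> (R - X)))"
    unfolding sum_Pow_insert[OF insert.hyps(1,2)] using insert.hyps(2)
    by (intro arg_cong2[of _ _ _ _ "(+)"] sum.cong arg_cong2[of _ _ _ _ "cell_weight E p"]) auto
  also have "\<dots> = cell_weight E p T (insert a S) + cell_weight E p (insert a T) S"
    using insert.prems insert.hyps by (subst (1 2) insert.IH[symmetric]) auto
  also have "\<dots> = cell_weight E p T S"
    using cell_weight_split[OF E, of T S a p] insert.prems by simp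
  finally show ?case by simp
qed simp

text \<open>The atom \<open>I\<close> gets the weight of the cell in which exactly the events in
  \<open>I\<close> occur. Nonnegativity of the polynomial makes the weights nonnegative, and
  refining the cell \<open>T = {}\<close> yields both the total mass 1 and the avoidance
  probabilities.\<close>

lemma shearer_pmf:
  assumes E: "sym E" "irrefl E" and V: "finite V"
    and p: "\<And>i. i \<in> V \<Longrightarrow> 0 \<le> p i"
    and nonneg: "\<And>S. S \<subseteq> V \<Longrightarrow> 0 \<le> indep_poly E p S"
  obtains \<mu> :: "nat set pmf" where
    "\<And>S. S \<subseteq> V \<Longrightarrow> measure_pmf.prob \<mu> {I. I \<inter> S = {}} = indep_poly E p S"
proof -
  define m where "m I = (if I \<subseteq> V then cell_weight E p I (V - I) else 0)" for I
  have m_nonneg: "0 \<le> m I" for I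
    using p by (auto simp: m_def cell_weight_def intro!: mult_nonneg_nonneg prod_nonneg nonneg)
  have m_sum: "(\<Sum>I\<in>Pow (V - S). m I) = indep_poly E p S" if "S \<subseteq> V" for S
  proof -
    have "finite S" using that V finite_subset by auto
    then have "indep_poly E p S = (\<Sum>I\<in>Pow (V - S). cell_weight E p ({} \<union> I) (S \<union> (V - S - I)))"
      using V by (subst cell_weight_refine[OF E, symmetric]) (auto simp: cell_weight_def indep_def)
    also have "\<dots> = (\<Sum>I\<in>Pow (V - S). m I)"
      using that by (intro sum.cong) (auto simp: m_def intro!: arg_cong2[of _ _ _ _ "cell_weight E p"])
    finally show ?thesis by simp
  qed
  have nn: "(\<integral>\<^sup>+ I. ennreal (m I) \<partial>count_space UNIV) = 1"
  proof -
    have "(\<integral>\<^sup>+ I. ennreal (m I) \<partial>count_space UNIV) = (\<Sum>I\<in>Pow V. ennreal (m I))"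
      using V by (intro nn_integral_count_space') (auto simp: m_def)
    also have "\<dots> = ennreal (\<Sum>I\<in>Pow V. m I)"
      using m_nonneg by (intro sum_ennreal) auto
    finally show ?thesis using m_sum[of "{}"] by simp
  qed
  define \<mu> where "\<mu> = embed_pmf m"
  have pmf: "pmf \<mu> I = m I" for I
    unfolding \<mu>_def by (rule pmf_embed_pmf) (use m_nonneg nn in auto)
  have "measure_pmf.prob \<mu> {I. I \<inter> S = {}} = indep_poly E p S" if S: "S \<subseteq> V" for S
  proof -
    have "set_pmf \<mu> \<subseteq> Pow V" by (auto simp: set_pmf_eq pmf m_def split: if_splits)
    then have "measure_pmf.prob \<mu> {I. I \<inter> S = {}} = measure_pmf.prob \<mu> (Pow (V - S))"
      by (intro measure_pmf.finite_measure_eq_AE) (auto simp: AE_measure_pmf_iff)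
    also have "\<dots> = (\<Sum>I\<in>Pow (V - S). m I)"
      using V by (subst measure_measure_pmf_finite) (auto simp: pmf)
    finally show ?thesis using m_sum[OF S] by simp
  qed
  then show ?thesis by (rule that)
qed

section \<open>Random vertex sets as families of events\<close>

text \<open>The probability that \<open>i\<close> occurs and \<open>S\<close> is avoided is
  \<open>A S - A (insert i S)\<close>, so \<open>step\<close> is exactly the required independence;
  the case \<open>S = {}\<close> gives the marginals.\<close>

lemma admissible_pmf:
  fixes \<mu> :: "nat set pmf"
  assumes A: "\<And>S. S \<subseteq> {1..n} \<Longrightarrow> measure_pmf.prob \<mu> {I. I \<inter> S = {}} = A S"
    and step: "\<And>i S. i \<in> {1..n} \<Longrightarrow> S \<subseteq> {1..n} - (neighbors E i \<union> {i}) \<Longrightarrow>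
      A (insert i S) = (1 - p i) * A S"
  shows "admissible_events n E p (measure_pmf \<mu>) (\<lambda>i. {I. i \<in> I})"
    and "avoidance n (measure_pmf \<mu>) (\<lambda>i. {I. i \<in> I}) = A {1..n}"
proof -
  have avoid: "measure_pmf.prob \<mu> {I. \<forall>j\<in>S. j \<notin> I} = A S" if "S \<subseteq> {1..n}" for S
  proof -
    have "{I. \<forall>j\<in>S. j \<notin> I} = {I. I \<inter> S = {}}" by auto
    then show ?thesis using A[OF that] by simp
  qed
  have hit: "measure_pmf.prob \<mu> {I. i \<in> I \<and> (\<forall>j\<in>S. j \<notin> I)} = p i * A S"
    if i: "i \<in> {1..n}" and S: "S \<subseteq> {1..n} - (neighbors E i \<union> {i})" for i S
  proof -
    have "{I. i \<in> I \<and> (\<forall>j\<in>S. j \<notin> I)} = {I. \<forall>j\<in>S. j \<notin> I} - {I. \<forall>j\<in>insert i S. j \<notin> I}"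
      by auto
    then have "measure_pmf.prob \<mu> {I. i \<in> I \<and> (\<forall>j\<in>S. j \<notin> I)} = A S - A (insert i S)"
      using i S avoid[of S] avoid[of "insert i S"]
      by (simp add: measure_pmf.finite_measure_Diff Collect_mono subset_iff)
    then show ?thesis using step[OF i S] by (simp add: algebra_simps)
  qed
  have "A {} = 1" using A[of "{}"] by simp
  then have single: "measure_pmf.prob \<mu> {I. i \<in> I} = p i" if "i \<in> {1..n}" for i
    using hit[OF that, of "{}"] by simp
  have "dependency_graph n E (measure_pmf \<mu>) (\<lambda>i. {I. i \<in> I})"
    unfolding dependency_graph_def cond_prob_def
  proof (intro ballI allI impI)
    fix i J
    assume "i \<in> {1..n}" and J: "J \<subseteq> {1..n} - (neighbors E i \<union> {i})"
      and "0 < \<P>(x in measure_pmf \<mu>. \<forall>j\<in>J. x \<notin> {I. j \<in> I})"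
    then show "\<P>(x in measure_pmf \<mu>. x \<in> {I. i \<in> I} \<and> (\<forall>j\<in>J. x \<notin> {I. j \<in> I})) /
        \<P>(x in measure_pmf \<mu>. \<forall>j\<in>J. x \<notin> {I. j \<in> I}) = measure_pmf.prob \<mu> {I. i \<in> I}"
      using single hit avoid[of J] by force
  qed
  then show "admissible_events n E p (measure_pmf \<mu>) (\<lambda>i. {I. i \<in> I})"
    unfolding admissible_events_def using single by (simp add: measure_pmf.prob_space_axioms)
  show "avoidance n (measure_pmf \<mu>) (\<lambda>i. {I. i \<in> I}) = A {1..n}"
    using avoid[of "{1..n}"] by (simp add: avoidance_def)
qed

lemma prob_pair_pmf_Times:
  "measure_pmf.prob (pair_pmf \<mu> \<nu>) (A \<times> B) = measure_pmf.prob \<mu> A * measure_pmf.prob \<nu> B"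
proof -
  have "indicator (A \<times> B) (x, y) = indicator A x * (indicator B y :: ennreal)" for x y
    by (simp add: indicator_times)
  then have "emeasure (pair_pmf \<mu> \<nu>) (A \<times> B) = emeasure \<mu> A * emeasure \<nu> B"
    by (simp add: nn_integral_indicator[symmetric] nn_integral_pair_pmf' nn_integral_cmult
        nn_integral_multc del: nn_integral_indicator)
  then show ?thesis by (simp add: measure_def enn2real_mult)
qed

lemma independent_pmf:
  assumes "finite V" and q: "\<And>i. i \<in> V \<Longrightarrow> q i \<in> {0..1}"
  obtains \<mu> :: "nat set pmf" where
    "\<And>S. S \<subseteq> V \<Longrightarrow> measure_pmf.prob \<mu> {I. I \<inter> S = {}} = (\<Prod>i\<in>S. 1 - q i)"
proof -
  have eq: "indep_poly {} q S = (\<Prod>i\<in>S. 1 - q i)" if "S \<subseteq> V" for S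
    using that assms(1) by (intro indep_poly_no_edges) (rule finite_subset)
  have nonneg: "0 \<le> indep_poly {} q S" if "S \<subseteq> V" for S
    unfolding eq[OF that] using that q by (intro prod_nonneg) fastforce
  obtain \<mu> :: "nat set pmf" where
    "\<And>S. S \<subseteq> V \<Longrightarrow> measure_pmf.prob \<mu> {I. I \<inter> S = {}} = indep_poly {} q S"
    by (rule shearer_pmf[of "{}" V q]) (use assms nonneg in \<open>auto simp: sym_def irrefl_def\<close>)
  with eq show thesis by (intro that) simp
qed

text \<open>Mutually independent events fit every dependency graph, so the infimum in
  \<open>avoid\<close> is taken over a nonempty set.\<close>

lemma admissible_events_exists:
  assumes "\<And>i. i \<in> {1..n} \<Longrightarrow> p i \<in> {0..1}"
  shows "\<exists>(M :: nat set measure) F. admissible_events n E p M F"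
proof -
  obtain \<mu> :: "nat set pmf" where
    \<mu>: "\<And>S. S \<subseteq> {1..n} \<Longrightarrow> measure_pmf.prob \<mu> {I. I \<inter> S = {}} = (\<Prod>i\<in>S. 1 - p i)"
    using independent_pmf[of "{1..n}" p] assms by blast
  have "admissible_events n E p (measure_pmf \<mu>) (\<lambda>i. {I. i \<in> I})"
  proof (rule admissible_pmf(1)[OF \<mu>])
    fix i S assume "S \<subseteq> {1..n} - (neighbors E i \<union> {i})"
    then have "finite S" "i \<notin> S" using finite_subset[of S "{1..n}"] by auto
    then show "(\<Prod>j\<in>insert i S. 1 - p j) = (1 - p i) * (\<Prod>j\<in>S. 1 - p j)" by simp
  qed
  then show ?thesis by blast
qed

section \<open>Positivity of the independence polynomial on Shearer's set\<close>

text \<open>The witness is the union of Shearer's random set for \<open>p'\<close> and an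
  independent random set. A union misses \<open>S\<close> iff both parts do, so the avoidance
  probabilities multiply.\<close>

lemma avoid_le_indep_poly:
  assumes E: "sym E" "irrefl E"
    and p': "\<And>i. i \<in> {1..n} \<Longrightarrow> 0 \<le> p' i \<and> p' i \<le> p i \<and> p i < 1"
    and nonneg: "\<And>S. S \<subseteq> {1..n} \<Longrightarrow> 0 \<le> indep_poly E p' S"
  shows "avoid n E p \<le> indep_poly E p' {1..n} * (\<Prod>i\<in>{1..n}. (1 - p i) / (1 - p' i))"
proof -
  \<comment> \<open>Chosen so that \<open>(1 - p' i) * (1 - q i) = 1 - p i\<close>; it is a
    probability because \<open>p' i \<le> p i < 1\<close>.\<close>
  define q where "q i = 1 - (1 - p i) / (1 - p' i)" for i
  have q: "0 \<le> q i" "q i \<le> 1" if "i \<in> {1..n}" for i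
    using p'[OF that] by (auto simp: q_def field_simps)
  have fin: "finite S" if "S \<subseteq> {1..n}" for S using that finite_subset by auto
  obtain \<mu> where
    \<mu>: "\<And>S. S \<subseteq> {1..n} \<Longrightarrow> measure_pmf.prob \<mu> {I. I \<inter> S = {}} = indep_poly E p' S"
    by (rule shearer_pmf[OF E, of "{1..n}" p']) (use p' nonneg in auto)
  obtain \<nu> :: "nat set pmf" where
    \<nu>: "\<And>S. S \<subseteq> {1..n} \<Longrightarrow> measure_pmf.prob \<nu> {I. I \<inter> S = {}} = (\<Prod>i\<in>S. 1 - q i)"
    by (rule independent_pmf[of "{1..n}" q]) (use q in auto)
  define \<pi> where "\<pi> = map_pmf (\<lambda>(I, J). I \<union> J) (pair_pmf \<mu> \<nu>)"
  have \<pi>: "measure_pmf.prob \<pi> {I. I \<inter> S = {}} = indep_poly E p' S * (\<Prod>j\<in>S. 1 - q j)"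
    if S: "S \<subseteq> {1..n}" for S
  proof -
    have "(\<lambda>(I, J). I \<union> J) -` {I. I \<inter> S = {}} = {I. I \<inter> S = {}} \<times> {I. I \<inter> S = {}}"
      by auto
    then show ?thesis
      using \<mu>[OF S] \<nu>[OF S] by (simp add: \<pi>_def measure_map_pmf prob_pair_pmf_Times)
  qed
  have step: "indep_poly E p' (insert i S) * (\<Prod>j\<in>insert i S. 1 - q j) =
      (1 - p i) * (indep_poly E p' S * (\<Prod>j\<in>S. 1 - q j))"
    if i: "i \<in> {1..n}" and S: "S \<subseteq> {1..n} - (neighbors E i \<union> {i})" for i S
  proof -
    have "finite S" "i \<notin> S" "S - neighbors E i = S" using S fin by auto
    then have "indep_poly E p' (insert i S) = (1 - p' i) * indep_poly E p' S"
      "(\<Prod>j\<in>insert i S. 1 - q j) = (1 - q i) * (\<Prod>j\<in>S. 1 - q j)"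
      using indep_poly_insert[OF E, of S i p'] by (simp_all add: algebra_simps)
    then have "indep_poly E p' (insert i S) * (\<Prod>j\<in>insert i S. 1 - q j) =
        ((1 - p' i) * (1 - q i)) * (indep_poly E p' S * (\<Prod>j\<in>S. 1 - q j))"
      by (simp only: mult_ac)
    moreover have "(1 - p' i) * (1 - q i) = 1 - p i" using p'[OF i] by (simp add: q_def)
    ultimately show ?thesis by simp
  qed
  have "avoid n E p \<le> avoidance n (measure_pmf \<pi>) (\<lambda>i. {I. i \<in> I})"
    by (rule avoid_le_avoidance, rule admissible_pmf(1)[OF \<pi> step])
  also have "\<dots> = indep_poly E p' {1..n} * (\<Prod>j\<in>{1..n}. 1 - q j)"
    by (rule admissible_pmf(2)[OF \<pi> step])
  finally show ?thesis by (simp add: q_def)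
qed

lemma indep_poly_pos:
  assumes E: "sym E" "irrefl E"
    and p: "\<And>i. i \<in> {1..n} \<Longrightarrow> p i \<in> {0..<1}"
    and avoid: "0 < avoid n E p"
    and S: "S \<subseteq> {1..n}"
  shows "0 < indep_poly E p S"
proof (rule ccontr)
  assume neg: "\<not> 0 < indep_poly E p S"
  have fin: "finite T" if "T \<subseteq> {1..n}" for T using that finite_subset by auto
  define P where "P T \<longleftrightarrow> T \<subseteq> {1..n} \<and> indep_poly E p T \<le> 0" for T
  have "P S" using S neg by (simp add: P_def)
  \<comment> \<open>Minimal cardinality makes the polynomial positive on every proper subset of
    \<open>T\<close>.\<close>
  then obtain T where T: "P T" and minimal: "\<And>U. card U < card T \<Longrightarrow> \<not> P U"
    using ex_has_least_nat[of P S card] by (meson linorder_not_less)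
  have sub: "T \<subseteq> {1..n}" using T by (simp add: P_def)
  have pos: "0 < indep_poly E p U" if "U \<subset> T" for U
    using minimal[of U] that sub psubset_card_mono[OF fin[OF sub] that] by (auto simp: P_def)
  have "T \<noteq> {}" using T by (auto simp: P_def)
  then obtain i where i: "i \<in> T" by blast
  define R where "R = T - {i}"
  have R: "T = insert i R" "i \<notin> R" "finite R" "R \<subset> T" using i fin[OF sub] by (auto simp: R_def)
  \<comment> \<open>By the recursion at \<open>i\<close>, this is the value of \<open>p i\<close>
    that makes the polynomial of \<open>T\<close> vanish.\<close>
  define c where "c = indep_poly E p R / indep_poly E p (R - neighbors E i)"
  have pR: "0 < indep_poly E p R" "0 < indep_poly E p (R - neighbors E i)"
    using R by (auto intro!: pos)
  have pT: "indep_poly E p R - p i * indep_poly E p (R - neighbors E i) \<le> 0"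
    using T indep_poly_insert[OF E R(3,2), of p] R(1) by (simp add: P_def)
  have c: "0 < c" "c \<le> p i" using pR pT by (auto simp: c_def field_simps)
  \<comment> \<open>Weight 0 outside \<open>T\<close> reduces every vertex set \<open>U\<close> to
    \<open>U \<inter> T\<close>; in particular the polynomial of \<open>{1..n}\<close> becomes that
    of \<open>T\<close>, which is 0.\<close>
  define p' where "p' j = (if j = i then c else if j \<in> T then p j else 0)" for j
  have p'R: "indep_poly E p' U = indep_poly E p U" if "U \<subseteq> R" for U
    using that R by (intro indep_poly_cong) (auto simp: p'_def)
  have zero: "indep_poly E p' T = 0"
    using indep_poly_insert[OF E R(3,2), of p'] p'R[of R] p'R[of "R - neighbors E i"] pR R(1)
    by (simp add: p'_def c_def)
  have nonneg_T: "0 \<le> indep_poly E p' U" if "U \<subseteq> T" for U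
  proof (cases "U = T \<or> U \<subseteq> R")
    case True
    then show ?thesis
    proof
      assume "U \<subseteq> R"
      then have "U \<subset> T" using R(4) by blast
      then show ?thesis using p'R[OF \<open>U \<subseteq> R\<close>] pos[of U] by simp
    qed (simp add: zero)
  next
    case False
    define U' where "U' = U - {i}"
    have U': "U = insert i U'" "i \<notin> U'" "U' \<subseteq> R" "U \<subset> T"
      using False that by (auto simp: U'_def R_def)
    have "finite U'" using U' R finite_subset by auto
    note ins = indep_poly_insert[OF E this U'(2)]
    have "0 < indep_poly E p U" using pos U' by auto
    \<comment> \<open>Here \<open>i \<in> U \<subset> T\<close>. The polynomial is affine in the
      weight of \<open>i\<close> with negative slope, so lowering \<open>p i\<close> to
      \<open>c\<close> cannot decrease it.\<close>
    also have "\<dots> \<le> indep_poly E p' U"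
    proof -
      have "U' - neighbors E i \<subseteq> R" "U' - neighbors E i \<subset> T" using U' R by auto
      then have "c * indep_poly E p (U' - neighbors E i) \<le> p i * indep_poly E p (U' - neighbors E i)"
        using c pos by (intro mult_right_mono) (auto intro: less_imp_le)
      then show ?thesis
        unfolding U'(1) ins using p'R[OF U'(3)] p'R[OF \<open>U' - neighbors E i \<subseteq> R\<close>] by (simp add: p'_def)
    qed
    finally show ?thesis by simp
  qed
  have restrict: "indep_poly E p' U = indep_poly E p' (U \<inter> T)" if "U \<subseteq> {1..n}" for U
  proof -
    have "p' j = 0" if "j \<in> U - T" for j using that i by (auto simp: p'_def)
    then show ?thesis
      using indep_poly_outside[OF E, of "U \<inter> T" "U - T" p'] fin[OF that] by (simp add: Int_Diff_Un)
  qed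
  have "avoid n E p \<le> indep_poly E p' {1..n} * (\<Prod>i\<in>{1..n}. (1 - p i) / (1 - p' i))"
  proof (rule avoid_le_indep_poly[OF E])
    show "0 \<le> indep_poly E p' U" if "U \<subseteq> {1..n}" for U
      using restrict[OF that] nonneg_T by simp
  qed (use p c in \<open>auto simp: p'_def\<close>)
  moreover have "indep_poly E p' {1..n} = 0"
    using restrict[of "{1..n}"] zero sub by (simp add: Int_absorb1)
  ultimately show False using avoid by simp
qed

subsection \<open>Self-bounding walks\<close>

text \<open>The elements of \<open>N\<close> are inserted in increasing order and the bounds
  telescope; the maximum comes last, hence the induction. The sets \<open>{k\<in>N. k < j}\<close>
  match the rule that a step to \<open>j\<close> forbids the neighbors from \<open>j\<close>
  upwards.\<close>

lemma insert_chain_ge: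
  fixes f :: "nat set \<Rightarrow> real"
  assumes "finite N"
    and "\<And>j. j \<in> N \<Longrightarrow> 0 \<le> g j"
    and "\<And>j. j \<in> N \<Longrightarrow> g j * f (S \<union> {k\<in>N. k < j}) \<le> f (insert j (S \<union> {k\<in>N. k < j}))"
  shows "(\<Prod>j\<in>N. g j) * f S \<le> f (S \<union> N)"
  using assms
proof (induction N rule: finite_linorder_max_induct)
  case (insert b A)
  have b: "b \<notin> A" "{k \<in> insert b A. k < b} = A" using insert.hyps by auto
  have eq: "{k \<in> insert b A. k < j} = {k \<in> A. k < j}" if "j \<in> A" for j
    using insert.hyps(2) that by fastforce
  have "(\<Prod>j\<in>A. g j) * f S \<le> f (S \<union> A)"
  proof (rule insert.IH)
    fix j assume j: "j \<in> A"
    then show "0 \<le> g j" using insert.prems(1) by simp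
    show "g j * f (S \<union> {k\<in>A. k < j}) \<le> f (insert j (S \<union> {k\<in>A. k < j}))"
      using insert.prems(2)[of j] j by (simp only: eq[OF j] insertI2 simp_thms)
  qed
  then have "g b * ((\<Prod>j\<in>A. g j) * f S) \<le> g b * f (S \<union> A)"
    using insert.prems(1)[of b] by (intro mult_left_mono) auto
  also have "\<dots> \<le> f (insert b (S \<union> A))"
    using insert.prems(2)[of b] b by simp
  finally show ?case
    using insert.hyps(1) b by (simp add: mult.assoc)
qed simp

text \<open>The inequality applies to both \<open>f\<close> and \<open>- f\<close>, since it puts no
  sign condition on \<open>f\<close>.\<close>

lemma insert_chain_eq:
  fixes f :: "nat set \<Rightarrow> real"
  assumes "finite N"
    and "\<And>j. j \<in> N \<Longrightarrow> 0 \<le> g j"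
    and "\<And>j. j \<in> N \<Longrightarrow> f (insert j (S \<union> {k\<in>N. k < j})) = g j * f (S \<union> {k\<in>N. k < j})"
  shows "f (S \<union> N) = (\<Prod>j\<in>N. g j) * f S"
  using insert_chain_ge[of N g f S] insert_chain_ge[of N g "\<lambda>X. - f X" S] assms by force

lemma self_bounding_walkD:
  assumes "simple_graph_on n E" "self_bounding n E w D"
  shows "w \<in> walks n E" "last w \<in> D" "D \<subseteq> {1..n}"
  using assms(2)
proof (induction)
  case (step w D i j)
  {
    case 1
    then show ?case using step assms(1)
      by (auto simp: walks_def successively_append_iff neighbors_def simple_graph_on_def)
  next
    case 2
    then show ?case using step by auto
  next
    case 3
    then show ?case using step assms(1) by (auto simp: neighbors_def simple_graph_on_def)
  }
qed (auto simp: walks_def)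

lemma self_bounding_det:
  assumes "self_bounding n E w D" "self_bounding n E w D'"
  shows "D = D'"
  using assms
proof (induction arbitrary: D')
  case (start i)
  from start(2) show ?case
  proof cases
    case (step w D i j)
    then show ?thesis by (auto elim: self_bounding.cases)
  qed auto
next
  case (step w D i j)
  from step.prems show ?case
  proof cases
    case (start i)
    then show ?thesis using step.hyps(1) by (auto elim: self_bounding.cases)
  next
    case (step w' D2 i' j')
    then show ?thesis using step.IH[of D2] step.hyps by auto
  qed
qed

lemma self_bounding_snoc_iff:
  assumes "self_bounding n E w D"
  shows "self_bounding n E (w @ [j]) D' \<longleftrightarrow>
    j \<in> neighbors E (last w) - D \<and> D' = D \<union> {k \<in> neighbors E (last w). k \<ge> j}"
proof
  have w: "w \<noteq> []" using assms by (auto elim: self_bounding.cases)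
  assume "self_bounding n E (w @ [j]) D'"
  then show "j \<in> neighbors E (last w) - D \<and> D' = D \<union> {k \<in> neighbors E (last w). k \<ge> j}"
  proof cases
    case (step w' D2 i' j')
    then show ?thesis using self_bounding_det[OF assms, of D2] by auto
  qed (use w in auto)
qed (use assms in \<open>auto intro: self_bounding.step\<close>)

section \<open>From walk conditions to a lower bound on avoidance\<close>

text \<open>The combinatorial core, separated from probability: \<open>Q S\<close> stands for the
  probability of avoiding \<open>S\<close>, and \<open>\<rho> w\<close> for the number attached to
  the class of \<open>w\<close>.\<close>

lemma self_bounding_lower_bound:
  fixes Q :: "nat set \<Rightarrow> real" and \<rho> :: "nat list \<Rightarrow> real"
  assumes G: "simple_graph_on n E"
    and W: "self_bounding_walks n E \<subseteq> W" "W \<subseteq> walks n E"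
    and \<rho>: "\<And>w. w \<in> W \<Longrightarrow> \<rho> w \<in> {0..<1}"
    and p: "\<And>w. w \<in> W \<Longrightarrow> p (last w) \<le> \<rho> w * (\<Prod>y\<in>Ext W w. 1 - \<rho> y)"
    and Q0: "Q {} = 1"
    and Q: "\<And>i S. i \<in> {1..n} \<Longrightarrow> S \<subseteq> {1..n} \<Longrightarrow> i \<notin> S \<Longrightarrow>
      Q S - p i * Q (S - neighbors E i) \<le> Q (insert i S)"
  shows "(\<Prod>i\<in>{1..n}. 1 - \<rho> [i]) \<le> Q {1..n}"
proof -
  have sb: "w \<in> W" if "self_bounding n E w D" for w D
    using that W(1) by (auto simp: self_bounding_walks_def)
  \<comment> \<open>Both claims are proved together: the ratio bound for smaller sets gives
    positivity at \<open>S\<close>, and positivity of \<open>Q S'\<close> is needed to multiply the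
    walk condition by it.\<close>
  have "0 < Q S \<and> (\<forall>w D. self_bounding n E w D \<longrightarrow> D \<inter> S = {} \<longrightarrow>
      (1 - \<rho> w) * Q S \<le> Q (insert (last w) S))" if "finite S" "S \<subseteq> {1..n}" for S
    using that
  proof (induction S rule: finite_psubset_induct)
    case (psubset S)
    have IH: "(1 - \<rho> w) * Q T \<le> Q (insert (last w) T)"
      if "T \<subset> S" "self_bounding n E w D" "D \<inter> T = {}" for w D T
      using psubset.IH[of T] psubset.prems that by auto
    have pos: "0 < Q S"
    proof (cases "S = {}")
      case False
      then obtain i where i: "i \<in> S" by auto
      then have s: "self_bounding n E [i] {i}"
        using psubset.prems by (intro self_bounding.start) auto
      have "S - {i} \<subset> S" "S - {i} \<subseteq> {1..n}" using i psubset.prems by auto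
      then have "0 < Q (S - {i})" using psubset.IH by blast
      then have "0 < (1 - \<rho> [i]) * Q (S - {i})"
        using \<rho>[OF sb[OF s]] by auto
      also have "\<dots> \<le> Q (insert i (S - {i}))"
        using IH[of "S - {i}" "[i]" "{i}"] s i by auto
      finally show ?thesis using i by (simp add: insert_absorb)
    qed (simp add: Q0)
    have "(1 - \<rho> w) * Q S \<le> Q (insert (last w) S)"
      if w: "self_bounding n E w D" and D: "D \<inter> S = {}" for w D
    proof -
      define N S' where "N = S \<inter> neighbors E (last w)" and "S' = S - neighbors E (last w)"
      have S: "S = S' \<union> N" by (auto simp: N_def S'_def)
      have last: "last w \<in> {1..n}" "last w \<notin> S"
        using self_bounding_walkD[OF G w] D by auto
      have ext: "self_bounding n E (w @ [j]) (D \<union> {k \<in> neighbors E (last w). k \<ge> j})" if "j \<in> N" for j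
        using self_bounding_snoc_iff[OF w] that D by (auto simp: N_def)
      have N: "finite N" using psubset.hyps by (simp add: N_def)
      have S'_pos: "0 < Q S'"
        using psubset.IH[of S'] psubset.prems pos by (cases "S' = S") (auto simp: S'_def)
      have chain: "(\<Prod>j\<in>N. 1 - \<rho> (w @ [j])) * Q S' \<le> Q S"
        unfolding S
      proof (rule insert_chain_ge)
        fix j assume j: "j \<in> N"
        show "0 \<le> 1 - \<rho> (w @ [j])" using \<rho>[OF sb[OF ext[OF j]]] by auto
        \<comment> \<open>The set lacks \<open>j\<close>, so it is smaller than \<open>S\<close>,
          and it avoids everything forbidden after the step to \<open>j\<close>. So the induction
          hypothesis applies to the extended walk.\<close>
        have "S' \<union> {k \<in> N. k < j} \<subset> S" using j by (auto simp: N_def S'_def)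
        moreover have "(D \<union> {k \<in> neighbors E (last w). k \<ge> j}) \<inter> (S' \<union> {k \<in> N. k < j}) = {}"
          using D by (auto simp: N_def S'_def)
        ultimately show "(1 - \<rho> (w @ [j])) * Q (S' \<union> {k \<in> N. k < j}) \<le> Q (insert j (S' \<union> {k \<in> N. k < j}))"
          using IH[OF _ ext[OF j]] by simp
      qed (rule N)
      \<comment> \<open>This makes \<open>Ext W w\<close> finite, so that its product can be
        split.\<close>
      have Ext: "Ext W w \<subseteq> (\<lambda>j. w @ [j]) ` {1..n}"
        using W(2) by (fastforce simp: Ext_def walks_def)
      have "(\<Prod>y\<in>Ext W w. 1 - \<rho> y) \<le> (\<Prod>y\<in>(\<lambda>j. w @ [j]) ` N. 1 - \<rho> y)"
      proof -
        have sub: "(\<lambda>j. w @ [j]) ` N \<subseteq> Ext W w"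
          using sb[OF ext] by (auto simp: Ext_def)
        have bnd: "0 \<le> 1 - \<rho> y \<and> 1 - \<rho> y \<le> 1" if "y \<in> Ext W w" for y
          using that \<rho>[of y] by (auto simp: Ext_def)
        have "(\<Prod>y\<in>Ext W w. 1 - \<rho> y) =
            (\<Prod>y\<in>Ext W w - (\<lambda>j. w @ [j]) ` N. 1 - \<rho> y) * (\<Prod>y\<in>(\<lambda>j. w @ [j]) ` N. 1 - \<rho> y)"
          using sub Ext by (intro prod.subset_diff) (auto intro: finite_subset)
        also have "\<dots> \<le> 1 * (\<Prod>y\<in>(\<lambda>j. w @ [j]) ` N. 1 - \<rho> y)"
          using bnd sub by (intro mult_right_mono prod_le_1 prod_nonneg) auto
        finally show ?thesis by simp
      qed
      also have "\<dots> = (\<Prod>j\<in>N. 1 - \<rho> (w @ [j]))"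
        by (subst prod.reindex) (auto simp: inj_on_def)
      finally have prods: "(\<Prod>y\<in>Ext W w. 1 - \<rho> y) \<le> (\<Prod>j\<in>N. 1 - \<rho> (w @ [j]))" .
      have \<rho>w: "0 \<le> \<rho> w" using \<rho>[OF sb[OF w]] by auto
      \<comment> \<open>Adding \<open>last w\<close> to \<open>S\<close> costs at most
        \<open>p (last w) * Q S'\<close>, which is thus at most the fraction \<open>\<rho> w\<close>
        of \<open>Q S\<close>.\<close>
      have "p (last w) * Q S' \<le> (\<rho> w * (\<Prod>j\<in>N. 1 - \<rho> (w @ [j]))) * Q S'"
        using p[OF sb[OF w]] mult_left_mono[OF prods \<rho>w] S'_pos by (intro mult_right_mono) auto
      also have "\<dots> \<le> \<rho> w * Q S"
        using mult_left_mono[OF chain \<rho>w] by (simp add: mult.assoc)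
      finally show ?thesis
        using Q[OF last(1) psubset.prems last(2)] by (simp add: S'_def algebra_simps)
    qed
    with pos show ?case by blast
  qed
  note claim = this
  have "(\<Prod>i\<in>S. 1 - \<rho> [i]) \<le> Q S" if "finite S" "S \<subseteq> {1..n}" for S
    using that
  proof (induction S)
    case (insert i S)
    have s: "self_bounding n E [i] {i}" using insert.prems by (intro self_bounding.start) auto
    have "(1 - \<rho> [i]) * (\<Prod>i\<in>S. 1 - \<rho> [i]) \<le> (1 - \<rho> [i]) * Q S"
      using insert \<rho>[OF sb[OF s]] by (intro mult_left_mono) auto
    also have "\<dots> \<le> Q (insert i S)"
      using claim[of S] s insert by fastforce
    finally show ?case using insert.hyps by simp
  qed (simp add: Q0)
  then show ?thesis by simp
qed

text \<open>Adding \<open>i\<close> to \<open>S\<close> loses the probability that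
  \<open>F i\<close> occurs while \<open>S\<close> is avoided. Avoiding only the non-neighbors
  \<open>J\<close> enlarges this event, and there the dependency graph yields the factor
  \<open>p i\<close>.\<close>

lemma avoidance_lower_bound:
  fixes M :: "'a measure" and \<rho> :: "nat list \<Rightarrow> real"
  assumes G: "simple_graph_on n E"
    and W: "self_bounding_walks n E \<subseteq> W" "W \<subseteq> walks n E"
    and \<rho>: "\<And>w. w \<in> W \<Longrightarrow> \<rho> w \<in> {0..<1}"
    and p: "\<And>w. w \<in> W \<Longrightarrow> p (last w) \<le> \<rho> w * (\<Prod>y\<in>Ext W w. 1 - \<rho> y)"
    and adm: "admissible_events n E p M F"
  shows "(\<Prod>i\<in>{1..n}. 1 - \<rho> [i]) \<le> avoidance n M F"
proof -
  interpret prob_space M using adm by (simp add: admissible_events_def)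
  define A where "A S = {x \<in> space M. \<forall>j\<in>S. x \<notin> F j}" for S
  have F: "F i \<in> sets M" "prob (F i) = p i" if "i \<in> {1..n}" for i
    using adm that by (auto simp: admissible_events_def)
  have A: "A S \<in> sets M" if "S \<subseteq> {1..n}" for S
    unfolding A_def
  proof (rule sets.sets_Collect_finite_All)
    show "finite S" using that finite_subset by auto
    show "{x \<in> space M. x \<notin> F j} \<in> sets M" if "j \<in> S" for j
      using F(1)[of j] \<open>S \<subseteq> {1..n}\<close> that by auto
  qed
  have "prob (A S) - p i * prob (A (S - neighbors E i)) \<le> prob (A (insert i S))"
    if i: "i \<in> {1..n}" and S: "S \<subseteq> {1..n}" "i \<notin> S" for i S
  proof -
    define J where "J = S - neighbors E i"
    have J: "J \<subseteq> {1..n} - (neighbors E i \<union> {i})" using S by (auto simp: J_def)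
    have sp: "{x \<in> space M. x \<in> F i \<and> (\<forall>j\<in>J. x \<notin> F j)} = F i \<inter> A J"
      using sets.sets_into_space[OF F(1)[OF i]] by (auto simp: A_def)
    have "prob (A S) - prob (A (insert i S)) = prob (F i \<inter> A S)"
    proof -
      have "F i \<inter> A S = A S - A (insert i S)"
        using sets.sets_into_space[OF F(1)[OF i]] by (auto simp: A_def)
      moreover have "A S \<in> sets M" "A (insert i S) \<in> sets M" "A (insert i S) \<subseteq> A S"
        using i S by (auto intro!: A) (auto simp: A_def)
      ultimately show ?thesis by (simp add: finite_measure_Diff)
    qed
    also have "\<dots> \<le> prob (F i \<inter> A J)"
      using F(1)[OF i] A[of J] J by (intro finite_measure_mono) (auto simp: A_def J_def)
    also have "\<dots> \<le> p i * prob (A J)"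
    \<comment> \<open>The dependency condition speaks only of conditioning events of positive
      probability; in the null case both sides vanish.\<close>
    proof (cases "prob (A J) = 0")
      case True
      then have "prob (F i \<inter> A J) \<le> 0"
        using A[of J] J finite_measure_mono[of "F i \<inter> A J" "A J"] by auto
      then show ?thesis using True by simp
    next
      case False
      then have pos: "0 < prob (A J)" by (simp add: zero_less_measure_iff)
      have "\<P>(x in M. x \<in> F i \<and> (\<forall>j\<in>J. x \<notin> F j)) / \<P>(x in M. \<forall>j\<in>J. x \<notin> F j) = prob (F i)"
        using adm i J pos
        unfolding admissible_events_def dependency_graph_def cond_prob_def A_def by blast
      then have "prob (F i \<inter> A J) / prob (A J) = p i"
        unfolding sp A_def[symmetric] F(2)[OF i] .
      with pos show ?thesis by (simp add: field_simps)
    qed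
    finally show ?thesis by (simp add: J_def)
  qed
  then have "(\<Prod>i\<in>{1..n}. 1 - \<rho> [i]) \<le> prob (A {1..n})"
    using prob_space by (intro self_bounding_lower_bound[OF G W \<rho> p]) (auto simp: A_def)
  then show ?thesis by (simp add: avoidance_def A_def)
qed

section \<open>Numbers that depend only on the class of a walk\<close>

lemma prod_Ext:
  "(\<Prod>y\<in>Ext W w. f y) = (\<Prod>x | w @ [x] \<in> W. f (w @ [x]))"
proof -
  have "Ext W w = (\<lambda>x. w @ [x]) ` {x. w @ [x] \<in> W}" by (auto simp: Ext_def)
  then show ?thesis by (simp add: prod.reindex inj_on_def)
qed

lemma equiv_walk_rel: "equiv W (walk_rel W)"
  by (auto simp: walk_rel_def equiv_def refl_on_def sym_def trans_def)

lemma walk_rel_snoc: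
  assumes "(w, w') \<in> walk_rel W" "w @ [x] \<in> W"
  shows "(w @ [x], w' @ [x]) \<in> walk_rel W"
proof -
  have eq: "w @ z \<in> W \<longleftrightarrow> w' @ z \<in> W" for z using assms(1) by (auto simp: walk_rel_def)
  then show ?thesis using assms(2) eq[of "x # _"] by (auto simp: walk_rel_def)
qed

text \<open>Related walks have corresponding extensions, on which \<open>s\<close> agrees by
  induction on \<open>m\<close>. The products in \<open>rec\<close> then coincide and are positive,
  so they cancel.\<close>

lemma ratio_invariant:
  fixes s :: "nat list \<Rightarrow> real" and m :: "nat list \<Rightarrow> nat"
  assumes s: "\<And>w. w \<in> W \<Longrightarrow> s w < 1"
    and rec: "\<And>w. w \<in> W \<Longrightarrow> p (last w) = s w * (\<Prod>y\<in>Ext W w. 1 - s y)"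
    and m: "\<And>w x. w \<in> W \<Longrightarrow> w @ [x] \<in> W \<Longrightarrow> m (w @ [x]) < m w"
    and "(w, w') \<in> walk_rel W"
  shows "s w = s w'"
  using assms(4)
proof (induction "m w" arbitrary: w w' rule: less_induct)
  case less
  have W: "w \<in> W" "w' \<in> W" and last: "last w = last w'"
    and ext: "{z. w @ z \<in> W} = {z. w' @ z \<in> W}"
    using less.prems by (auto simp: walk_rel_def)
  let ?P = "\<Prod>x | w @ [x] \<in> W. 1 - s (w @ [x])"
  have "?P = (\<Prod>x | w' @ [x] \<in> W. 1 - s (w' @ [x]))"
  proof (rule prod.cong)
    show "{x. w @ [x] \<in> W} = {x. w' @ [x] \<in> W}" using ext by auto
    fix x assume "x \<in> {x. w' @ [x] \<in> W}"
    then have "w @ [x] \<in> W" using ext by auto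
    then show "1 - s (w @ [x]) = 1 - s (w' @ [x])"
      using less.hyps[OF m[OF W(1)] walk_rel_snoc[OF less.prems]] by simp
  qed
  then have "s w * ?P = s w' * ?P"
    using rec[OF W(1)] rec[OF W(2)] last unfolding prod_Ext by metis
  moreover have "0 < ?P" using s by (intro prod_pos) auto
  ultimately show ?case by simp
qed

text \<open>Under Shearer's extremal measure, \<open>s w\<close> is the conditional probability of
  the event \<open>last w\<close> given that no event in \<open>allowed w\<close> occurs.\<close>

lemma self_bounding_ratio:
  assumes G: "simple_graph_on n E"
    and p: "\<And>i. i \<in> {1..n} \<Longrightarrow> 0 \<le> p i"
    and pos: "\<And>S. S \<subseteq> {1..n} \<Longrightarrow> 0 < indep_poly E p S"
  defines "B \<equiv> self_bounding_walks n E"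
  obtains s where "\<And>w. w \<in> B \<Longrightarrow> s w \<in> {0..<1}"
    "\<And>w. w \<in> B \<Longrightarrow> p (last w) = s w * (\<Prod>y\<in>Ext B w. 1 - s y)"
    "\<And>w w'. (w, w') \<in> walk_rel B \<Longrightarrow> s w = s w'"
proof -
  have E: "sym E" "irrefl E" using G by (auto simp: simple_graph_on_def)
  define allowed where "allowed w = {1..n} - (THE D. self_bounding n E w D)" for w
  define s where
    "s w = 1 - indep_poly E p (insert (last w) (allowed w)) / indep_poly E p (allowed w)" for w
  have allowed: "allowed w = {1..n} - D" if "self_bounding n E w D" for w D
  proof -
    have "(THE D. self_bounding n E w D) = D"
      using that self_bounding_det[OF _ that] by (rule the_equality)
    then show ?thesis by (simp add: allowed_def)
  qed
  have props: "last w \<in> {1..n}" "last w \<notin> allowed w" "allowed w \<subseteq> {1..n}"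
    "w @ [j] \<in> B \<longleftrightarrow> j \<in> allowed w \<inter> neighbors E (last w)"
    "w @ [j] \<in> B \<Longrightarrow> allowed (w @ [j]) =
      (allowed w - neighbors E (last w)) \<union> {k \<in> allowed w \<inter> neighbors E (last w). k < j}"
    if w: "w \<in> B" for w j
  proof -
    obtain D where D: "self_bounding n E w D"
      using w unfolding B_def self_bounding_walks_def by blast
    have N: "neighbors E (last w) \<subseteq> {1..n}"
      using G by (auto simp: simple_graph_on_def neighbors_def)
    show "last w \<in> {1..n}" "last w \<notin> allowed w" "allowed w \<subseteq> {1..n}"
      using self_bounding_walkD[OF G D] unfolding allowed[OF D] by blast+
    show "w @ [j] \<in> B \<longleftrightarrow> j \<in> allowed w \<inter> neighbors E (last w)"
      using N unfolding B_def self_bounding_walks_def allowed[OF D] mem_Collect_eq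
        self_bounding_snoc_iff[OF D] by blast
    assume "w @ [j] \<in> B"
    then have "self_bounding n E (w @ [j]) (D \<union> {k \<in> neighbors E (last w). k \<ge> j})"
      unfolding B_def self_bounding_walks_def mem_Collect_eq self_bounding_snoc_iff[OF D] by blast
    from allowed[OF this] have "allowed (w @ [j]) = {1..n} - (D \<union> {k \<in> neighbors E (last w). k \<ge> j})" .
    also have "\<dots> = (allowed w - neighbors E (last w)) \<union> {k \<in> allowed w \<inter> neighbors E (last w). k < j}"
      unfolding allowed[OF D] by (auto simp: linorder_not_le)
    finally show "allowed (w @ [j]) =
      (allowed w - neighbors E (last w)) \<union> {k \<in> allowed w \<inter> neighbors E (last w). k < j}" .
  qed
  have fin: "finite (allowed w)" for w by (simp add: allowed_def)
  \<comment> \<open>This form shows \<open>0 \<le> s w\<close>, while the definition shows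
    \<open>s w < 1\<close>.\<close>
  have s_eq: "s w = p (last w) * indep_poly E p (allowed w - neighbors E (last w)) / indep_poly E p (allowed w)"
    if "w \<in> B" for w
    using indep_poly_insert[OF E fin props(2)[OF that], of p] pos[OF props(3)[OF that]]
    by (simp add: s_def field_simps)
  have s01: "s w \<in> {0..<1}" if w: "w \<in> B" for w
  proof -
    have "0 \<le> p (last w)" "0 < indep_poly E p (allowed w - neighbors E (last w))"
      "0 < indep_poly E p (allowed w)" "0 < indep_poly E p (insert (last w) (allowed w))"
      using props(1,3)[OF w] by (auto intro!: p pos)
    then have "0 \<le> s w" "s w < 1" by (simp add: s_eq[OF w], simp add: s_def)
    then show ?thesis by simp
  qed
  have rec: "p (last w) = s w * (\<Prod>y\<in>Ext B w. 1 - s y)" if w: "w \<in> B" for w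
  proof -
    define N S where "N = allowed w \<inter> neighbors E (last w)" and "S = allowed w - neighbors E (last w)"
    have ext: "{j. w @ [j] \<in> B} = N" using props(4)[OF w] by (auto simp: N_def)
    \<comment> \<open>Each \<open>1 - s (w @ [j])\<close> is the ratio for inserting
      \<open>j\<close> after all smaller elements of \<open>N\<close>, so their product
      telescopes.\<close>
    have "indep_poly E p (S \<union> N) = (\<Prod>j\<in>N. 1 - s (w @ [j])) * indep_poly E p S"
    proof (rule insert_chain_eq)
      show "finite N" using fin by (simp add: N_def)
      fix j assume "j \<in> N"
      then have j: "w @ [j] \<in> B" using ext by auto
      show "0 \<le> 1 - s (w @ [j])" using s01[OF j] by auto
      have "allowed (w @ [j]) = S \<union> {k\<in>N. k < j}" using props(5)[OF w j] by (simp add: N_def S_def)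
      then show "indep_poly E p (insert j (S \<union> {k\<in>N. k < j})) =
          (1 - s (w @ [j])) * indep_poly E p (S \<union> {k\<in>N. k < j})"
        using pos[OF props(3)[OF j]] by (simp add: s_def)
    qed
    moreover have "S \<union> N = allowed w" by (auto simp: S_def N_def)
    moreover have "0 < indep_poly E p S" "0 < indep_poly E p (allowed w)"
      using props(3)[OF w] by (auto simp: S_def intro!: pos)
    ultimately show ?thesis
      unfolding prod_Ext ext s_eq[OF w] S_def[symmetric] by (auto simp: field_simps)
  qed
  \<comment> \<open>A step to \<open>x\<close> forbids \<open>x\<close> itself, so the allowed set
    shrinks strictly.\<close>
  have dec: "card (allowed (w @ [x])) < card (allowed w)" if "w \<in> B" "w @ [x] \<in> B" for w x
    using props(4)[OF that(1), of x] props(5)[OF that] that(2)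
    by (intro psubset_card_mono fin) auto
  have "s w = s w'" if "(w, w') \<in> walk_rel B" for w w'
  proof (rule ratio_invariant[where W = B and m = "\<lambda>w. card (allowed w)" and p = p and s = s])
    show "s w < 1" if "w \<in> B" for w using s01[OF that] by simp
  qed (fact rec dec that)+
  with s01 rec show ?thesis by (rule that)
qed

section \<open>The characterization of Shearer's set by walks\<close>

theorem corollary1:
  fixes n :: nat and E :: "(nat \<times> nat) set" and p :: "nat \<Rightarrow> real"
  assumes "simple_graph_on n E"
    and "\<And>i. i \<in> {1..n} \<Longrightarrow> p i \<in> {0..<1}"
  shows "p \<in> shearer_set n E \<longleftrightarrow>
    (\<exists>W (r :: nat list set \<Rightarrow> real).
       self_bounding_walks n E \<subseteq> W \<and> W \<subseteq> walks n E \<and>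
       (\<forall>c\<in>walk_classes W. r c \<in> {0..<1}) \<and>
       (\<forall>c\<in>walk_classes W. \<forall>w\<in>c.
          p (last w) \<le> r c * (\<Prod>y\<in>Ext W w. 1 - r (walk_class W y))))"
    (is "_ \<longleftrightarrow> (\<exists>W r. ?cond W r)")
proof
  have E: "sym E" "irrefl E"
    using assms(1) by (auto simp: simple_graph_on_def)
  assume "p \<in> shearer_set n E"
  then have "0 < avoid n E p" by (simp add: shearer_set_def)
  then have pos: "0 < indep_poly E p S" if "S \<subseteq> {1..n}" for S
    using indep_poly_pos[OF E assms(2) _ that] by simp
  have p0: "0 \<le> p i" if "i \<in> {1..n}" for i using assms(2)[OF that] by simp
  define B where "B = self_bounding_walks n E"
  obtain s where s: "\<And>w. w \<in> B \<Longrightarrow> s w \<in> {0..<1}"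
    "\<And>w. w \<in> B \<Longrightarrow> p (last w) = s w * (\<Prod>y\<in>Ext B w. 1 - s y)"
    "\<And>w w'. (w, w') \<in> walk_rel B \<Longrightarrow> s w = s w'"
    unfolding B_def using self_bounding_ratio[OF assms(1) p0 pos] by blast
  \<comment> \<open>Any representative gives the same value, because \<open>s\<close> is constant on
    classes.\<close>
  define r where "r c = s (SOME w. w \<in> c)" for c
  have r: "r c = s w" "w \<in> B" if c: "c \<in> walk_classes B" "w \<in> c" for c w
  proof -
    have "(SOME w. w \<in> c) \<in> c" using c(2) by (rule someI)
    with c have rel: "(SOME w. w \<in> c, w) \<in> walk_rel B"
      unfolding walk_classes_def by (blast intro: in_quotient_imp_in_rel[OF equiv_walk_rel])
    from s(3)[OF rel] show "r c = s w" by (simp add: r_def)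
    from rel show "w \<in> B" by (simp add: walk_rel_def)
  qed
  have r_class: "r (walk_class B y) = s y" if "y \<in> B" for y
    using that equiv_class_self[OF equiv_walk_rel that]
    by (intro r(1)) (simp_all add: walk_class_def walk_classes_def quotientI)
  have "?cond B r"
  proof (intro conjI ballI)
    show "self_bounding_walks n E \<subseteq> B" by (simp add: B_def)
    show "B \<subseteq> walks n E"
      using self_bounding_walkD(1)[OF assms(1)] by (auto simp: B_def self_bounding_walks_def)
    fix c assume c: "c \<in> walk_classes B"
    then obtain w where "w \<in> c"
      using in_quotient_imp_non_empty[OF equiv_walk_rel] unfolding walk_classes_def by blast
    then show "r c \<in> {0..<1}" using r[OF c \<open>w \<in> c\<close>] s(1)[of w] by simp
    fix w assume w: "w \<in> c"
    have "(\<Prod>y\<in>Ext B w. 1 - r (walk_class B y)) = (\<Prod>y\<in>Ext B w. 1 - s y)"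
      by (intro prod.cong) (auto simp: Ext_def r_class)
    then show "p (last w) \<le> r c * (\<Prod>y\<in>Ext B w. 1 - r (walk_class B y))"
      using s(2)[of w] r[OF c w] by simp
  qed
  then show "\<exists>W r. ?cond W r" by blast
next
  assume "\<exists>W r. ?cond W r"
  then obtain W r where W: "self_bounding_walks n E \<subseteq> W" "W \<subseteq> walks n E"
    and r: "\<forall>c\<in>walk_classes W. r c \<in> {0..<1}"
    and le: "\<forall>c\<in>walk_classes W. \<forall>w\<in>c.
      p (last w) \<le> r c * (\<Prod>y\<in>Ext W w. 1 - r (walk_class W y))"
    by blast
  define \<rho> where "\<rho> w = r (walk_class W w)" for w
  have cls: "walk_class W w \<in> walk_classes W" "w \<in> walk_class W w" if "w \<in> W" for w
    using that equiv_class_self[OF equiv_walk_rel that]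
    by (simp_all add: walk_class_def walk_classes_def quotientI)
  have \<rho>: "\<rho> w \<in> {0..<1}" if "w \<in> W" for w using r cls[OF that] by (simp add: \<rho>_def)
  have le': "p (last w) \<le> \<rho> w * (\<Prod>y\<in>Ext W w. 1 - \<rho> y)" if "w \<in> W" for w
    using le cls[OF that] by (simp add: \<rho>_def)
  have "[i] \<in> W" if "i \<in> {1..n}" for i
    using W(1) self_bounding.start[OF that] by (auto simp: self_bounding_walks_def)
  then have "\<rho> [i] < 1" if "i \<in> {1..n}" for i using \<rho>[of "[i]"] that by simp
  then have "0 < (\<Prod>i\<in>{1..n}. 1 - \<rho> [i])" by (intro prod_pos) simp
  \<comment> \<open>The bound is the same for every admissible family, so it passes to the
    infimum.\<close>
  also have "\<dots> \<le> avoid n E p"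
    unfolding avoid_def
  proof (rule cInf_greatest)
    have "\<exists>(M :: nat set measure) F. admissible_events n E p M F"
      using assms(2) by (intro admissible_events_exists) (auto intro: less_imp_le)
    then show "{avoidance n M F |(M :: nat set measure) F. admissible_events n E p M F} \<noteq> {}"
      by blast
  qed (use avoidance_lower_bound[OF assms(1) W \<rho> le'] in auto)
  finally show "p \<in> shearer_set n E" using assms(2) by (simp add: shearer_set_def)
qed

end
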